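(* For all sufficiently large $n$, $\hat{R}_{\mathrm{ind}}(P_n)\leq 5\cdot 10^{7}n$.
   Context: $P_n$ denotes the path on $n$ vertices. For a graph $H$, the (two-colour) induced size-Ramsey number $\hat{R}_{\mathrm{ind}}(H)$ is the smallest integer $m$ such that there exists a graph $G$ with $m$ edges with the property that for every colouring of the edges of $G$ with $2$ colours, there is a monochromatic copy of $H$ in $G$ which is an induced subgraph of $G$. *)

theory Defs
  imports Complex_Main "HOL-Library.Extended_Nat"
begin

record 'a ugraph =
  vertices :: "'a set"
  edges :: "'a set set"

definition simple_graph :: "'a ugraph \<Rightarrow> bool" where
  "simple_graph G \<longleftrightarrow> finite (vertices G) \<and> (\<forall>e\<in>edges G. e \<subseteq> vertices G \<and> card e = 2)"

definition graph_iso :: "'a ugraph \<Rightarrow> 'b ugraph \<Rightarrow> bool" where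
  "graph_iso H K \<longleftrightarrow> (\<exists>f. bij_betw f (vertices H) (vertices K) \<and>
     (\<forall>u\<in>vertices H. \<forall>v\<in>vertices H. {u, v} \<in> edges H \<longleftrightarrow> {f u, f v} \<in> edges K))"

definition is_induced_subgraph :: "'a ugraph \<Rightarrow> 'a ugraph \<Rightarrow> bool" where
  "is_induced_subgraph K G \<longleftrightarrow>
     vertices K \<subseteq> vertices G \<and> edges K = {e \<in> edges G. e \<subseteq> vertices K}"

definition monochromatic :: "('a set \<Rightarrow> 'c) \<Rightarrow> 'a ugraph \<Rightarrow> bool" where
  "monochromatic c K \<longleftrightarrow> (\<exists>col. \<forall>e\<in>edges K. c e = col)"

text \<open>The two colours are the booleans. A colouring is a total function on vertex sets, but only
  its values on the edges of \<open>G\<close> matter.\<close>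

definition induced_ramsey_for :: "'a ugraph \<Rightarrow> 'b ugraph \<Rightarrow> bool" where
  "induced_ramsey_for G H \<longleftrightarrow>
     (\<forall>c :: 'a set \<Rightarrow> bool. \<exists>K. is_induced_subgraph K G \<and> graph_iso H K \<and> monochromatic c K)"

text \<open>Host graphs range over finite graphs on natural numbers, which covers all finite graphs up to
  isomorphism. The infimum is taken in the extended naturals, so the value is the least
  \<open>m\<close> if some host graph exists and \<open>\<infinity>\<close> otherwise; with \<^typ>\<open>nat\<close> the value
  in the latter case would be an arbitrary number.\<close>

definition ind_size_ramsey :: "'a ugraph \<Rightarrow> enat" where
  "ind_size_ramsey H = Inf (enat ` {m. \<exists>G :: nat ugraph.
     simple_graph G \<and> card (edges G) = m \<and> induced_ramsey_for G H})"

definition path_graph :: "nat \<Rightarrow> nat ugraph" where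
  "path_graph n = \<lparr>vertices = {..<n}, edges = {{i, Suc i} |i. Suc i < n}\<rparr>"

end

theory Submission
  imports Defs "HOL-Library.FuncSet" "HOL-Library.Disjoint_Sets"
begin

text \<open>The host graph comes from a uniformly random sequence of \<open>M = 126 N\<close> ordered pairs of
  vertices, \<open>N = 200000 n\<close>; repetitions and loops do no harm, since edges are counted by index.
  For a vertex set \<open>S\<close> call two indices a cherry if both pairs have an end in \<open>S\<close> and they share
  the other end. A union bound shows that for some sequence no set of size \<open>2 n\<close> has \<open>20 n\<close>
  pairwise disjoint cherries.

  Given a colouring, take a majority colour and a vertex set \<open>W\<close> maximising
  \<open>e(W) - 62 |W|\<close> in that colour, so that every \<open>D \<subseteq> W\<close> meets at least \<open>62 |D|\<close> edges of
  \<open>W\<close>. Run a depth first search inside \<open>W\<close> that extends the current path \<open>P\<close> only by a vertex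
  whose sole neighbour on \<open>P\<close> is the end of \<open>P\<close>, and otherwise moves the end of \<open>P\<close> to a set
  \<open>D\<close> of dead vertices. Every unvisited vertex joined in colour to \<open>D\<close> then has two neighbours in
  \<open>P \<union> D\<close>. If \<open>P\<close> stays short until \<open>|D| = n\<close>, the at least \<open>62 n\<close> edges meeting \<open>D\<close> yield
  \<open>20 n\<close> disjoint cherries for \<open>P \<union> D\<close>, a contradiction.\<close>

section \<open>Depth first search for induced paths\<close>

text \<open>Two edge sets occur because inducedness concerns all host edges \<open>E\<close>, while
  consecutive vertices must be joined in the chosen colour \<open>R\<close>. The head of the list is
  the active end of the search path, so extending and retreating are list operations.\<close>

fun ind_path :: "'a set set \<Rightarrow> 'a set set \<Rightarrow> 'a list \<Rightarrow> bool" where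
  "ind_path E R [] = True"
| "ind_path E R (p # ps) \<longleftrightarrow> ind_path E R ps \<and> p \<notin> set ps \<and>
     (\<forall>w\<in>set ps. {p, w} \<in> E \<longleftrightarrow> w = hd ps) \<and> (ps \<noteq> [] \<longrightarrow> {p, hd ps} \<in> R)"

lemma ind_path_distinct: "ind_path E R P \<Longrightarrow> distinct P"
  by (induction P) auto

text \<open>The head is adjacent only to the next entry, and distinctness turns this into a
  condition on indices. Excluding singletons from \<open>E\<close> settles \<open>i = j\<close>,
  where the pair collapses.\<close>

lemma ind_path_nth:
  assumes "ind_path E R P" "\<And>v. {v} \<notin> E" "i < length P" "j < length P"
  shows "{P ! i, P ! j} \<in> E \<longleftrightarrow> j = Suc i \<or> i = Suc j"
  using assms
proof (induction P arbitrary: i j)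
  case Nil
  then show ?case by simp
next
  case (Cons p ps)
  have d: "distinct ps" using Cons.prems(1) ind_path_distinct by auto
  have *: "{p, ps ! k} \<in> E \<longleftrightarrow> k = 0" if "k < length ps" for k
  proof -
    have "hd ps = ps ! 0" using that by (cases ps) auto
    moreover have "ps ! k = ps ! 0 \<longleftrightarrow> k = 0"
      by (rule nth_eq_iff_index_eq[OF d that le_less_trans[OF le0 that]])
    ultimately show ?thesis using Cons.prems(1) that by auto
  qed
  show ?case
    using Cons * by (cases i; cases j) (auto simp: insert_commute)
qed

lemma ind_path_nth_Suc:
  assumes "ind_path E R P" "Suc i < length P"
  shows "{P ! i, P ! Suc i} \<in> R"
  using assms
proof (induction P arbitrary: i)
  case Nil
  then show ?case by simp
next
  case (Cons p ps)
  then show ?case by (cases i) (auto simp: hd_conv_nth)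
qed

text \<open>The search is phrased as an extremal argument: in a state of maximal potential neither
  search step is possible. The invariant on dead vertices survives both steps because
  \<open>set P \<union> D\<close> only grows.\<close>

lemma dfs_induced_path:
  fixes E R :: "'a set set"
  assumes "finite W" "R \<subseteq> E"
  obtains P D where "ind_path E R P" "set P \<subseteq> W" "D \<subseteq> W" "set P \<inter> D = {}"
    "\<And>d u. d \<in> D \<Longrightarrow> u \<in> W \<Longrightarrow> u \<notin> set P \<Longrightarrow> u \<notin> D \<Longrightarrow> {d, u} \<in> R \<Longrightarrow>
       \<exists>w\<in>set P \<union> D. w \<noteq> d \<and> {w, u} \<in> E"
    "length P \<le> n" "card D \<le> m" "length P = n \<or> card D = m \<or> D = W"
proof -
  define ok where "ok \<equiv> \<lambda>(P, D). ind_path E R P \<and> set P \<subseteq> W \<and> D \<subseteq> W \<and> set P \<inter> D = {} \<and>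
    (\<forall>d\<in>D. \<forall>u\<in>W. u \<notin> set P \<longrightarrow> u \<notin> D \<longrightarrow> {d, u} \<in> R \<longrightarrow>
       (\<exists>w\<in>set P \<union> D. w \<noteq> d \<and> {w, u} \<in> E)) \<and> length P \<le> n \<and> card D \<le> m"
  \<comment> \<open>A dead vertex weighs twice a path vertex, so extending the path and moving its
    end to \<open>D\<close> each raise \<open>mu\<close> by 1.\<close>
  define mu :: "'a list \<times> 'a set \<Rightarrow> nat" where "mu \<equiv> \<lambda>(P, D). length P + 2 * card D"
  have "ok ([], {})" by (simp add: ok_def)
  moreover have "\<forall>x. ok x \<longrightarrow> mu x < Suc (n + 2 * m)"
    by (auto simp: ok_def mu_def)
  ultimately obtain x where "ok x" and max: "\<And>y. ok y \<Longrightarrow> mu y \<le> mu x"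
    using ex_has_greatest_nat[of ok _ mu] by blast
  obtain P D where x: "x = (P, D)" by (cases x)
  note ok = \<open>ok x\<close>[unfolded x ok_def prod.case]
  have "length P = n \<or> card D = m \<or> D = W"
  proof (rule ccontr)
    assume "\<not> ?thesis"
    then have lt: "length P < n" "card D < m" and "D \<noteq> W" using ok by auto
    show False
    proof (cases P)
      case Nil
      obtain u where "u \<in> W" "u \<notin> D" using ok \<open>D \<noteq> W\<close> by auto
      then have "ok ([u], D)" using ok lt Nil by (auto simp: ok_def)
      from max[OF this] show False by (simp add: mu_def x Nil)
    next
      case (Cons p ps)
      have p: "p \<in> W" "p \<notin> D" "p \<notin> set ps" using ok Cons by auto
      show False
      \<comment> \<open>Either some \<open>u\<close> extends the path and keeps it induced, or every
        unvisited \<open>R\<close>-neighbour of \<open>p\<close> has an \<open>E\<close>-neighbour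
        in \<open>ps\<close>. In the second case that neighbour is the second witness required when
        \<open>p\<close> dies.\<close>
      proof (cases "\<exists>u\<in>W. u \<notin> set P \<and> u \<notin> D \<and> {p, u} \<in> R \<and> (\<forall>w\<in>set ps. {w, u} \<notin> E)")
        case True
        then obtain u where u: "u \<in> W" "u \<notin> set P" "u \<notin> D" "{p, u} \<in> R"
          "\<forall>w\<in>set ps. {w, u} \<notin> E" by blast
        then have "ind_path E R (u # P)"
          using ok Cons assms(2) p by (auto simp: insert_commute)
        moreover have "\<exists>w\<in>set (u # P) \<union> D. w \<noteq> d \<and> {w, v} \<in> E"
          if "d \<in> D" "v \<in> W" "v \<notin> set (u # P)" "v \<notin> D" "{d, v} \<in> R" for d v
        proof -
          have "\<exists>w\<in>set P \<union> D. w \<noteq> d \<and> {w, v} \<in> E" using that ok by auto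
          then show ?thesis by auto
        qed
        ultimately have "ok (u # P, D)" using ok lt u unfolding ok_def prod.case by simp
        from max[OF this] show False by (simp add: mu_def x)
      next
        case False
        have fin: "finite D" using ok assms(1) finite_subset by blast
        have "\<exists>w\<in>set ps \<union> insert p D. w \<noteq> d \<and> {w, u} \<in> E"
          if du: "d \<in> insert p D" "u \<in> W" "u \<notin> set ps" "u \<notin> insert p D" "{d, u} \<in> R" for d u
        proof (cases "d = p")
          case True
          then obtain w where "w \<in> set ps" "{w, u} \<in> E" using False du Cons by auto
          then show ?thesis using True p by (intro bexI[of _ w]) auto
        next
          case False
          then have "\<exists>w\<in>set P \<union> D. w \<noteq> d \<and> {w, u} \<in> E" using du ok Cons by auto
          then show ?thesis using Cons by auto
        qed
        then have "ok (ps, insert p D)" using ok lt Cons fin p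
          unfolding ok_def prod.case by (simp add: card_insert_if)
        from max[OF this] show False using fin p by (simp add: mu_def x Cons)
      qed
    qed
  qed
  with ok that[of P D] show thesis by blast
qed

text \<open>Choose \<open>W\<close> maximising the number of edges inside it minus
  \<open>\<rho> * card W\<close>. Comparison with \<open>V\<close> gives the first bound; comparison
  with \<open>W - D\<close> gives the second, since deleting \<open>D\<close> loses exactly the
  edges meeting it.\<close>

lemma dense_subset:
  fixes g :: "'i \<Rightarrow> 'a set" and \<rho> :: nat
  assumes "finite V" "finite I" "\<And>i. i \<in> I \<Longrightarrow> g i \<subseteq> V"
  obtains W where "W \<subseteq> V"
    "card I + \<rho> * card W \<le> card {i\<in>I. g i \<subseteq> W} + \<rho> * card V"
    "\<And>D. D \<subseteq> W \<Longrightarrow> \<rho> * card D \<le> card {i\<in>I. g i \<subseteq> W \<and> g i \<inter> D \<noteq> {}}"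
proof -
  \<comment> \<open>Integer values, as the difference can be negative.\<close>
  define h where "h W = int (card {i\<in>I. g i \<subseteq> W}) - int (\<rho> * card W)" for W
  obtain W where W: "W \<in> Pow V" "Max (h ` Pow V) = h W"
    by (rule obtains_MAX[of "Pow V" h]) (use assms(1) in auto)
  have max: "h U \<le> h W" if "U \<subseteq> V" for U
    unfolding W(2)[symmetric] by (rule Max_ge) (use that assms(1) in auto)
  have finW: "finite W" using W assms(1) finite_subset by auto
  have I: "{i\<in>I. g i \<subseteq> V} = I" using assms(3) by auto
  have 1: "card I + \<rho> * card W \<le> card {i\<in>I. g i \<subseteq> W} + \<rho> * card V"
    using max[OF order_refl] unfolding h_def I by linarith
  have 2: "\<rho> * card D \<le> card {i\<in>I. g i \<subseteq> W \<and> g i \<inter> D \<noteq> {}}" if "D \<subseteq> W" for D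
  proof -
    have split: "{i\<in>I. g i \<subseteq> W} = {i\<in>I. g i \<subseteq> W \<and> g i \<inter> D \<noteq> {}} \<union> {i\<in>I. g i \<subseteq> W - D}" by auto
    have "card {i\<in>I. g i \<subseteq> W} \<le>
        card {i\<in>I. g i \<subseteq> W \<and> g i \<inter> D \<noteq> {}} + card {i\<in>I. g i \<subseteq> W - D}"
      by (subst split) (rule card_Un_le)
    moreover have "card W = card (W - D) + card D"
      using that finW by (simp add: card_Diff_subset card_mono finite_subset)
    then have "\<rho> * card W = \<rho> * card (W - D) + \<rho> * card D"
      by (simp only: add_mult_distrib2)
    moreover have "h (W - D) \<le> h W" using max W by blast
    ultimately show ?thesis unfolding h_def by linarith
  qed
  show thesis using that W 1 2 by blast
qed

section \<open>Cherries\<close>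

definition spoke :: "'a set \<Rightarrow> 'a \<Rightarrow> 'a \<times> 'a \<Rightarrow> bool" where
  "spoke S b e \<longleftrightarrow> (\<exists>a\<in>S. e = (a, b) \<or> e = (b, a))"

text \<open>Cherries consist of indices rather than edges, so disjoint cherries constrain disjoint
  sets of coordinates of the sequence \<open>f\<close>. The two pairs may coincide, and the shared
  end may lie in \<open>S\<close>.\<close>

definition cherry :: "'a set \<Rightarrow> ('i \<Rightarrow> 'a \<times> 'a) \<Rightarrow> 'i set \<Rightarrow> bool" where
  "cherry S f q \<longleftrightarrow> (\<exists>i j b. i \<noteq> j \<and> q = {i, j} \<and> spoke S b (f i) \<and> spoke S b (f j))"

definition cherry_family :: "'i set \<Rightarrow> 'a set \<Rightarrow> ('i \<Rightarrow> 'a \<times> 'a) \<Rightarrow> 'i set set \<Rightarrow> bool" where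
  "cherry_family I S f Q \<longleftrightarrow> disjoint Q \<and> Q \<subseteq> Pow I \<and> (\<forall>q\<in>Q. cherry S f q)"

lemma spoke_mono: "S \<subseteq> S' \<Longrightarrow> spoke S b e \<Longrightarrow> spoke S' b e"
  by (auto simp: spoke_def)

lemma cherry_mono: "S \<subseteq> S' \<Longrightarrow> cherry S f q \<Longrightarrow> cherry S' f q"
  unfolding cherry_def by (blast intro: spoke_mono)

lemma spoke_outside_unique:
  assumes "spoke S b e" "spoke S b' e" "b \<notin> S"
  shows "b' = b"
  using assms by (auto simp: spoke_def)

text \<open>Take a maximal family \<open>Q\<close>; no two uncovered indices share an end
  \<open>b\<close>. Covered indices number at most \<open>2 * card Q\<close>. Uncovered ones in
  \<open>J\<close> have distinct \<open>t\<close>: at most \<open>card S\<close> with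
  \<open>t\<close> in \<open>S\<close>, and at most one per cherry with \<open>t\<close> outside, as
  the partner \<open>j\<close> is then covered by a cherry that determines \<open>t\<close>.\<close>

lemma many_disjoint_cherries:
  fixes f :: "'i \<Rightarrow> 'a \<times> 'a"
  assumes fin: "finite I" "finite S" and J: "J \<subseteq> I"
    and J_spoke: "\<And>i. i \<in> J \<Longrightarrow> spoke S (t i) (f i)"
    and J_out: "\<And>i. i \<in> J \<Longrightarrow> t i \<notin> S \<Longrightarrow> \<exists>j\<in>I. j \<noteq> i \<and> spoke S (t i) (f j)"
  obtains Q where "cherry_family I S f Q" "card J \<le> 3 * card Q + card S"
proof -
  have "finite {Q. cherry_family I S f Q}"
    by (rule finite_subset[of _ "Pow (Pow I)"]) (use fin in \<open>auto simp: cherry_family_def\<close>)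
  moreover have "cherry_family I S f {}" by (simp add: cherry_family_def disjoint_def)
  ultimately obtain Q where Q: "cherry_family I S f Q"
    and max: "\<And>Q'. cherry_family I S f Q' \<Longrightarrow> Q \<subseteq> Q' \<Longrightarrow> Q' = Q"
    using finite_has_maximal2[of "{Q. cherry_family I S f Q}" "{}"] by auto
  have finQ: "finite Q" using Q fin(1) finite_subset[of Q "Pow I"] by (auto simp: cherry_family_def)
  have no: "i = j" if "i \<in> I" "j \<in> I" "i \<notin> \<Union>Q" "j \<notin> \<Union>Q" "spoke S b (f i)" "spoke S b (f j)"
    for i j b
  proof (rule ccontr)
    assume "i \<noteq> j"
    then have "cherry S f {i, j}" using that by (auto simp: cherry_def)
    then have "cherry_family I S f (insert {i, j} Q)"
      using Q that by (auto simp: cherry_family_def disjoint_def)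
    then have "insert {i, j} Q = Q" using max by blast
    then show False using that by blast
  qed
  define J1 where "J1 = {i\<in>J. i \<notin> \<Union>Q \<and> t i \<in> S}"
  define J2 where "J2 = {i\<in>J. i \<notin> \<Union>Q \<and> t i \<notin> S}"
  have inj_t: "i = j" if "i \<in> J" "j \<in> J" "i \<notin> \<Union>Q" "j \<notin> \<Union>Q" "t i = t j" for i j
    using no[of i j "t i"] that J J_spoke[of i] J_spoke[of j] by auto
  have "card J1 \<le> card S"
    by (rule card_inj_on_le[of t]) (auto simp: inj_on_def J1_def inj_t fin)
  moreover have "card J2 \<le> card Q"
  proof -
    have "\<exists>q\<in>Q. \<exists>j\<in>q. spoke S (t i) (f j)" if i: "i \<in> J2" for i
    proof -
      have i': "i \<in> J" "i \<notin> \<Union>Q" "t i \<notin> S" using i by (auto simp: J2_def)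
      obtain j where j: "j \<in> I" "j \<noteq> i" "spoke S (t i) (f j)" using J_out i' by blast
      then have "j \<in> \<Union>Q" using no[of i j "t i"] i' J J_spoke by auto
      then show ?thesis using j by auto
    qed
    then obtain q where q: "\<And>i. i \<in> J2 \<Longrightarrow> q i \<in> Q \<and> (\<exists>j\<in>q i. spoke S (t i) (f j))" by metis
    \<comment> \<open>One member of the cherry is a spoke at \<open>t i\<close>. Since
      \<open>t i\<close> is outside \<open>S\<close>, it is the only possible common end
      \<open>b\<close>.\<close>
    have center: "t i = b"
      if "i \<in> J2" "q i = {k, l}" "spoke S b (f k)" "spoke S b (f l)" for i k l b
    proof -
      have "t i \<notin> S" using that by (auto simp: J2_def)
      then show ?thesis using q[OF that(1)] that(2-) spoke_outside_unique by fastforce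
    qed
    have "inj_on q J2"
    proof (rule inj_onI)
      fix i i' assume ii: "i \<in> J2" "i' \<in> J2" "q i = q i'"
      have "cherry S f (q i)" using q[OF ii(1)] Q by (auto simp: cherry_family_def)
      then obtain k l b where "q i = {k, l}" "spoke S b (f k)" "spoke S b (f l)"
        by (auto simp: cherry_def)
      then have "t i = b" "t i' = b" using center ii by auto
      then show "i = i'" using inj_t ii by (auto simp: J2_def)
    qed
    then show ?thesis by (rule card_inj_on_le) (use q finQ in auto)
  qed
  moreover have "card (\<Union>Q) \<le> 2 * card Q"
  proof -
    have "card (\<Union>Q) \<le> (\<Sum>q\<in>Q. card q)" by (rule card_Union_le_sum_card)
    also have "\<dots> \<le> (\<Sum>q\<in>Q. 2)"
      by (rule sum_mono) (use Q in \<open>auto simp: cherry_family_def cherry_def card_insert_if\<close>)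
    finally show ?thesis by simp
  qed
  moreover have "card J \<le> card (\<Union>Q) + card J1 + card J2"
  proof -
    have "finite (\<Union>Q)" using Q fin(1) by (auto simp: cherry_family_def intro: finite_subset)
    then have "finite (\<Union>Q \<union> J1 \<union> J2)"
      using finite_subset[OF J fin(1)] by (simp add: J1_def J2_def)
    then have "card J \<le> card (\<Union>Q \<union> J1 \<union> J2)" by (rule card_mono) (auto simp: J1_def J2_def)
    also have "\<dots> \<le> card (\<Union>Q) + card J1 + card J2"
      by (meson card_Un_le add_le_mono1 order_trans)
    finally show ?thesis .
  qed
  ultimately have "card J \<le> 3 * card Q + card S" by linarith
  then show thesis using that Q by blast
qed

section \<open>The union bound\<close>

text \<open>Such a pair of pairs is coded by two ends in \<open>S\<close>, the common end in
  \<open>V\<close> and two orientation bits.\<close>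

lemma card_spoke_pairs:
  assumes "finite V" "S \<subseteq> V"
  shows "finite {(e, e'). \<exists>b\<in>V. spoke S b e \<and> spoke S b e'}"
    and "card {(e, e'). \<exists>b\<in>V. spoke S b e \<and> spoke S b e'} \<le> 4 * (card S)\<^sup>2 * card V"
proof -
  let ?C = "{(e, e'). \<exists>b\<in>V. spoke S b e \<and> spoke S b e'}"
  let ?A = "S \<times> S \<times> V \<times> (UNIV :: bool set) \<times> (UNIV :: bool set)"
  define g :: "'a \<times> 'a \<times> 'a \<times> bool \<times> bool \<Rightarrow> ('a \<times> 'a) \<times> 'a \<times> 'a" where
    "g \<equiv> \<lambda>(a, c, b, x, y). (if x then (a, b) else (b, a), if y then (c, b) else (b, c))"
  have finA: "finite ?A" using finite_subset[OF assms(2,1)] assms(1) by simp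
  have sub: "?C \<subseteq> g ` ?A"
  proof clarify
    fix e1 e2 e1' e2' b
    assume "b \<in> V" "spoke S b (e1, e2)" "spoke S b (e1', e2')"
    then obtain a c x y where "a \<in> S" "c \<in> S"
      "(e1, e2) = (if x then (a, b) else (b, a))" "(e1', e2') = (if y then (c, b) else (b, c))"
      unfolding spoke_def by metis
    then show "((e1, e2), (e1', e2')) \<in> g ` ?A"
      using \<open>b \<in> V\<close> by (intro image_eqI[of _ _ "(a, c, b, x, y)"]) (auto simp: g_def)
  qed
  show "finite ?C" using sub finA finite_subset by blast
  have "card ?C \<le> card ?A" using sub finA surj_card_le by blast
  also have "\<dots> = 4 * (card S)\<^sup>2 * card V"
    by (simp add: card_cartesian_product power2_eq_square card_UNIV_bool del: UNIV_Times_UNIV)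
  finally show "card ?C \<le> 4 * (card S)\<^sup>2 * card V" .
qed

text \<open>For a random \<open>f\<close>, a given index pair is a cherry with probability at most
  \<open>4 * (card S)\<^sup>2 / card V ^ 3\<close>, and disjoint pairs are independent. Denominators
  are cleared to stay within the naturals.\<close>

lemma card_functions_with_cherries:
  fixes V S :: "'a set" and I :: "'i set"
  assumes "finite V" "S \<subseteq> V" "finite I" "finite Q" "disjoint Q" "Q \<subseteq> Pow I"
    and "\<And>q. q \<in> Q \<Longrightarrow> card q = 2"
  shows "card {f \<in> I \<rightarrow>\<^sub>E V \<times> V. \<forall>q\<in>Q. cherry S f q} * card V ^ (3 * card Q)
    \<le> (4 * (card S)\<^sup>2) ^ card Q * card V ^ (2 * card I)"
  using assms(4,3,5-)
proof (induction Q arbitrary: I rule: finite_induct)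
  case empty
  then show ?case
    by (simp add: card_PiE card_cartesian_product power_mult power2_eq_square)
next
  case (insert q Q)
  obtain i j where q: "q = {i, j}" "i \<noteq> j"
    using insert.prems(4)[of q] by (auto simp: card_2_iff)
  define I' where "I' = I - {i, j}"
  let ?F = "\<lambda>I Q. {f \<in> I \<rightarrow>\<^sub>E V \<times> V. \<forall>q\<in>Q. cherry S f q}"
  let ?C = "{(e, e'). \<exists>b\<in>V. spoke S b e \<and> spoke S b e'}"
  have I: "i \<in> I" "j \<in> I" using insert.prems q by auto
  have I': "I = insert i (insert j I')" "i \<notin> I'" "j \<notin> I'" "finite I'"
    using I insert.prems unfolding I'_def by auto
  have disj: "q' \<subseteq> I'" if "q' \<in> Q" for q'
  proof -
    have "q' \<inter> q = {}" using insert.prems(2) insert.hyps that by (auto simp: disjoint_def)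
    then show ?thesis using insert.prems(3) that q unfolding I'_def by auto
  qed
  have IH: "card (?F I' Q) * card V ^ (3 * card Q) \<le>
      (4 * (card S)\<^sup>2) ^ card Q * card V ^ (2 * card I')"
  proof (rule insert.IH)
    show "disjoint Q" using insert.prems(2) by (auto simp: disjoint_def)
  qed (use I' disj insert.prems in auto)
  have fin: "finite (?F I' Q)"
    by (rule finite_subset[of _ "I' \<rightarrow>\<^sub>E V \<times> V"]) (use assms(1) I' in \<open>auto intro: finite_PiE\<close>)
  note C = card_spoke_pairs[OF assms(1,2)]
  have "card (?F I (insert q Q)) \<le> card (?C \<times> ?F I' Q)"
  proof (rule card_inj_on_le)
    \<comment> \<open>A function is determined by its values at \<open>i\<close> and
      \<open>j\<close> together with its restriction to \<open>I'\<close>, being extensional on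
      \<open>I\<close>.\<close>
    let ?h = "\<lambda>f. ((f i, f j), restrict f I')"
    show "inj_on ?h (?F I (insert q Q))"
    proof (rule inj_onI)
      fix f g assume fg: "f \<in> ?F I (insert q Q)" "g \<in> ?F I (insert q Q)" "?h f = ?h g"
      show "f = g"
      proof
        fix k
        show "f k = g k"
        proof (cases "k \<in> I")
          case True
          then show ?thesis using fg(3) I' by (auto dest!: fun_cong[of _ _ k])
        next
          case False
          then show ?thesis using fg by (auto simp: PiE_def extensional_def)
        qed
      qed
    qed
    show "?h ` ?F I (insert q Q) \<subseteq> ?C \<times> ?F I' Q"
    proof (rule image_subsetI)
      fix f assume f: "f \<in> ?F I (insert q Q)"
      then obtain k l b where b: "{i, j} = {k, l}" "spoke S b (f k)" "spoke S b (f l)"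
        using q by (auto simp: cherry_def)
      have fk: "f i \<in> V \<times> V" using f I by auto
      have sp: "spoke S b (f i)" "spoke S b (f j)" using b by (auto simp: doubleton_eq_iff)
      then have "b \<in> V" using fk by (auto simp: spoke_def)
      then have 1: "(f i, f j) \<in> ?C" using sp by auto
      have "cherry S (restrict f I') q'" if "q' \<in> Q" for q'
      proof -
        have "cherry S f q'" using f that by auto
        then show ?thesis using disj[OF that] unfolding cherry_def by fastforce
      qed
      then have 2: "restrict f I' \<in> ?F I' Q" using f I' by auto
      from 1 2 show "?h f \<in> ?C \<times> ?F I' Q" by blast
    qed
    show "finite (?C \<times> ?F I' Q)" using C(1) fin by (rule finite_cartesian_product)
  qed
  also have "\<dots> \<le> (4 * (card S)\<^sup>2 * card V) * card (?F I' Q)"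
    unfolding card_cartesian_product using C(2) by (rule mult_le_mono1)
  finally have "card (?F I (insert q Q)) * card V ^ (3 * card (insert q Q)) \<le>
      (4 * (card S)\<^sup>2 * card V) * card (?F I' Q) * card V ^ (3 * card (insert q Q))"
    by (rule mult_le_mono1)
  also have "\<dots> = (4 * (card S)\<^sup>2 * card V ^ 4) * (card (?F I' Q) * card V ^ (3 * card Q))"
    using insert.hyps by (simp add: power_add eval_nat_numeral)
  also have "\<dots> \<le> (4 * (card S)\<^sup>2 * card V ^ 4) *
      ((4 * (card S)\<^sup>2) ^ card Q * card V ^ (2 * card I'))"
    using IH by (rule mult_le_mono2)
  also have "\<dots> = (4 * (card S)\<^sup>2) ^ card (insert q Q) * card V ^ (2 * card I)"
    using insert.hyps I' q by (simp add: power_add eval_nat_numeral)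
  finally show ?case .
qed

text \<open>A single term of the exponential series gives \<open>k ^ k / fact k\<close> at most
  \<open>exp k\<close>, and \<open>exp 1\<close> is at most 3.\<close>

lemma binomial_le_power_3:
  fixes N k :: nat
  assumes "k > 0"
  shows "real (N choose k) \<le> (3 * real N / real k) ^ k"
proof -
  have "real k ^ k / fact k \<le> exp (real k)"
  proof -
    have s: "summable (\<lambda>n. real k ^ n / fact n)"
      using summable_exp[of "real k"] by (simp add: field_simps)
    have "(\<Sum>n\<in>{k}. real k ^ n / fact n) \<le> (\<Sum>n. real k ^ n / fact n)"
      by (rule sum_le_suminf[OF s]) auto
    then show ?thesis by (simp add: exp_def field_simps)
  qed
  also have "\<dots> = exp 1 ^ k" by (simp flip: exp_of_nat_mult)
  also have "\<dots> \<le> 3 ^ k" by (intro power_mono exp_le) auto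
  finally have *: "real k ^ k \<le> 3 ^ k * fact k" by (simp add: field_simps)
  have "real (N choose k) * fact k \<le> real N ^ k"
    using binomial_fact_pow[of N k] by (metis of_nat_fact of_nat_le_iff of_nat_mult of_nat_power)
  then have "real (N choose k) * fact k * real k ^ k \<le> real N ^ k * (3 ^ k * fact k)"
    using * by (intro mult_mono) auto
  then have "real (N choose k) * real k ^ k \<le> real N ^ k * 3 ^ k"
    by (simp add: mult.commute mult.left_commute)
  then show ?thesis using assms by (simp add: field_simps power_mult_distrib)
qed

text \<open>The factors count the sets of size \<open>2 * n\<close>, bound the families of
  \<open>20 * n\<close> index pairs, and, divided by the right side, bound the probability that all
  pairs of one family are cherries. Here \<open>16 * n ^ 2\<close> is
  \<open>4 * (2 * n) ^ 2\<close>.\<close>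

lemma few_cherries_numeric:
  fixes n N M :: nat
  assumes "n > 0" "N = 200000 * n" "M = 126 * N"
  shows "real (N choose (2 * n)) * real ((M choose 2) choose (20 * n)) * (16 * real n ^ 2) ^ (20 * n)
    < real N ^ (3 * (20 * n))"
proof -
  have "real (N choose (2 * n)) \<le> (3 * real N / real (2 * n)) ^ (2 * n)"
    using assms by (intro binomial_le_power_3) auto
  also have "3 * real N / real (2 * n) = 300000" using assms by simp
  finally have 1: "real (N choose (2 * n)) \<le> 300000 ^ (2 * n)" .
  have "real ((M choose 2) * 2) \<le> real (M ^ 2)"
    using binomial_fact_pow[of M 2] by (simp only: of_nat_le_iff fact_2)
  then have M2: "real (M choose 2) \<le> real M ^ 2 / 2" by simp
  have "3 * real (M choose 2) / real (20 * n) * (16 * real n ^ 2)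
      = real (M choose 2) * (12 / 5 * real n)"
    using assms(1) by (simp add: field_simps power2_eq_square)
  also have "\<dots> \<le> real M ^ 2 / 2 * (12 / 5 * real n)" by (rule mult_right_mono[OF M2]) simp
  \<comment> \<open>With \<open>M = 126 * N\<close> and \<open>n = N / 200000\<close> the exact
    coefficient is 0.095256.\<close>
  also have "\<dots> \<le> real N ^ 3 / 10"
    using assms by (simp add: power2_eq_square power3_eq_cube)
  finally have 2: "3 * real (M choose 2) / real (20 * n) * (16 * real n ^ 2) \<le> real N ^ 3 / 10" .
  have "real ((M choose 2) choose (20 * n)) * (16 * real n ^ 2) ^ (20 * n)
      \<le> (3 * real (M choose 2) / real (20 * n)) ^ (20 * n) * (16 * real n ^ 2) ^ (20 * n)"
    using assms(1) by (intro mult_right_mono binomial_le_power_3) auto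
  also have "\<dots> = (3 * real (M choose 2) / real (20 * n) * (16 * real n ^ 2)) ^ (20 * n)"
    by (rule power_mult_distrib[symmetric])
  also have "\<dots> \<le> (real N ^ 3 / 10) ^ (20 * n)"
    by (rule power_mono[OF 2]) simp
  finally have "real (N choose (2 * n)) *
      (real ((M choose 2) choose (20 * n)) * (16 * real n ^ 2) ^ (20 * n))
      \<le> 300000 ^ (2 * n) * (real N ^ 3 / 10) ^ (20 * n)"
    using 1 by (intro mult_mono) auto
  \<comment> \<open>The factor \<open>10 ^ 20\<close> from the families outweighs
    \<open>300000 ^ 2\<close> from the vertex sets, leaving \<open>9 / 10 ^ 10\<close> per unit of
    \<open>n\<close>.\<close>
  also have "\<dots> = (300000 ^ 2 / 10 ^ 20) ^ n * real N ^ (3 * (20 * n))"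
    by (simp only: power_divide power_mult) (simp flip: power_mult add: mult.commute)
  also have "\<dots> < real N ^ (3 * (20 * n))"
  proof -
    have "(300000 ^ 2 / 10 ^ 20 :: real) ^ n < 1"
      using assms(1) by (intro power_less_one_iff[THEN iffD2]) auto
    moreover have "real N ^ (3 * (20 * n)) > 0" using assms by simp
    ultimately show ?thesis
      using mult_strict_right_mono[of _ 1 "real N ^ (3 * (20 * n))"] by fastforce
  qed
  finally show ?thesis by (simp only: mult.assoc)
qed

lemma ex_few_disjoint_cherries:
  fixes n N M :: nat
  assumes n: "n > 0" and N: "N = 200000 * n" and M: "M = 126 * N"
  obtains f where "f \<in> {..<M} \<rightarrow> {..<N} \<times> {..<N}"
    "\<And>S Q. S \<subseteq> {..<N} \<Longrightarrow> card S \<le> 2 * n \<Longrightarrow> cherry_family {..<M} S f Q \<Longrightarrow> card Q < 20 * n"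
proof -
  let ?V = "{..<N}" and ?I = "{..<M}"
  \<comment> \<open>\<open>F (S, Q)\<close> is the set of sequences that are bad for
    \<open>S\<close> and \<open>Q\<close>. Sizes are fixed exactly in \<open>SS\<close> and
    \<open>QQ\<close>; smaller \<open>S\<close> and larger \<open>Q\<close> are reduced to these at
    the end.\<close>
  define F where "F = (\<lambda>(S, Q). {f \<in> ?I \<rightarrow>\<^sub>E ?V \<times> ?V. \<forall>q\<in>Q. cherry S f q})"
  define SS where "SS = {S. S \<subseteq> ?V \<and> card S = 2 * n}"
  define T where "T = {q. q \<subseteq> ?I \<and> card q = 2}"
  define QQ where "QQ = {Q. Q \<subseteq> T \<and> card Q = 20 * n \<and> disjoint Q}"
  have finT: "finite T" "card T = M choose 2" by (auto simp: T_def n_subsets)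
  have "finite SS" "card SS = N choose (2 * n)" by (auto simp: SS_def n_subsets)
  moreover have "finite QQ"
    by (rule finite_subset[of _ "Pow T"]) (auto simp: QQ_def finT)
  moreover have "card QQ \<le> card {Q. Q \<subseteq> T \<and> card Q = 20 * n}"
    by (rule card_mono) (auto simp: QQ_def finT)
  then have "card QQ \<le> (M choose 2) choose (20 * n)" by (simp add: n_subsets finT)
  ultimately have fin: "finite (SS \<times> QQ)"
    and card_le: "card (SS \<times> QQ) \<le> (N choose (2 * n)) * ((M choose 2) choose (20 * n))"
    by (auto simp: card_cartesian_product)
  have F: "card (F x) * N ^ (3 * (20 * n)) \<le> (16 * n\<^sup>2) ^ (20 * n) * N ^ (2 * M)"
    if "x \<in> SS \<times> QQ" for x
  proof -
    obtain S Q where x: "x = (S, Q)" "S \<in> SS" "Q \<in> QQ" using \<open>x \<in> SS \<times> QQ\<close> by auto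
    then have "card Q = 20 * n" "card S = 2 * n" "S \<subseteq> ?V" "disjoint Q" "Q \<subseteq> Pow ?I"
      "\<And>q. q \<in> Q \<Longrightarrow> card q = 2"
      by (auto simp: QQ_def SS_def T_def)
    moreover have "finite Q"
      using x(3) finite_subset[OF _ finT(1)] by (simp add: QQ_def)
    ultimately show ?thesis
      using card_functions_with_cherries[of ?V S ?I Q] x(1)
      by (simp add: F_def power_mult_distrib)
  qed
  have "card (\<Union>x\<in>SS \<times> QQ. F x) < card (?I \<rightarrow>\<^sub>E ?V \<times> ?V)"
  proof -
    have "card (\<Union>x\<in>SS \<times> QQ. F x) * N ^ (3 * (20 * n)) \<le>
        (\<Sum>x\<in>SS \<times> QQ. card (F x) * N ^ (3 * (20 * n)))"
      unfolding sum_distrib_right[symmetric] by (rule mult_le_mono1[OF card_UN_le[OF fin]])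
    also have "\<dots> \<le> (\<Sum>x\<in>SS \<times> QQ. (16 * n\<^sup>2) ^ (20 * n) * N ^ (2 * M))"
      by (rule sum_mono[OF F])
    also have "\<dots> = card (SS \<times> QQ) * ((16 * n\<^sup>2) ^ (20 * n) * N ^ (2 * M))"
      by simp
    also have "\<dots> \<le> (N choose (2 * n)) * ((M choose 2) choose (20 * n)) *
        ((16 * n\<^sup>2) ^ (20 * n) * N ^ (2 * M))"
      by (rule mult_le_mono1[OF card_le])
    also have "\<dots> = (N choose (2 * n)) * ((M choose 2) choose (20 * n)) * (16 * n\<^sup>2) ^ (20 * n)
        * N ^ (2 * M)"
      by (simp only: mult.assoc)
    also have "\<dots> < N ^ (3 * (20 * n)) * N ^ (2 * M)"
    proof (rule mult_strict_right_mono)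
      have "real ((N choose (2 * n)) * ((M choose 2) choose (20 * n)) * (16 * n\<^sup>2) ^ (20 * n))
          < real (N ^ (3 * (20 * n)))"
        using few_cherries_numeric[OF n N M] by simp
      then show "(N choose (2 * n)) * ((M choose 2) choose (20 * n)) * (16 * n\<^sup>2) ^ (20 * n)
          < N ^ (3 * (20 * n))"
        by (simp only: of_nat_less_iff)
    qed (use n N in simp)
    also have "\<dots> = N ^ (2 * M) * N ^ (3 * (20 * n))" by (rule mult.commute)
    finally have "card (\<Union>x\<in>SS \<times> QQ. F x) < N ^ (2 * M)"
      by (rule mult_less_le_imp_less[of _ _ 1 1, simplified] mult_right_less_imp_less) simp
    also have "\<dots> = card (?I \<rightarrow>\<^sub>E ?V \<times> ?V)"
      by (simp add: card_PiE card_cartesian_product power_mult power2_eq_square)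
    finally show ?thesis .
  qed
  moreover have "finite (\<Union>x\<in>SS \<times> QQ. F x)"
    by (rule finite_subset[of _ "?I \<rightarrow>\<^sub>E ?V \<times> ?V"]) (auto simp: F_def intro: finite_PiE)
  ultimately have "\<not> (?I \<rightarrow>\<^sub>E ?V \<times> ?V) \<subseteq> (\<Union>x\<in>SS \<times> QQ. F x)"
    by (meson card_mono not_less)
  then obtain f where f: "f \<in> ?I \<rightarrow>\<^sub>E ?V \<times> ?V" and nf: "\<And>x. x \<in> SS \<times> QQ \<Longrightarrow> f \<notin> F x"
    by blast
  have "card Q < 20 * n"
    if S: "S \<subseteq> ?V" "card S \<le> 2 * n" and Q: "cherry_family ?I S f Q" for S Q
  proof (rule ccontr)
    assume "\<not> card Q < 20 * n"
    then obtain Q' where Q': "Q' \<subseteq> Q" "card Q' = 20 * n"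
      using obtain_subset_with_card_n[of "20 * n" Q] by auto
    \<comment> \<open>Enlarging \<open>S\<close> preserves cherries, and there is room because
      \<open>2 * n\<close> is at most \<open>N\<close>.\<close>
    obtain S' where S': "S \<subseteq> S'" "S' \<subseteq> ?V" "card S' = 2 * n"
      using exists_subset_between[of S "2 * n" ?V] S N by auto
    have ch: "cherry S' f q" if "q \<in> Q'" for q
      using that Q' Q S' cherry_mono unfolding cherry_family_def by blast
    have "card q = 2" if "q \<in> Q'" for q
      using ch[OF that] by (auto simp: cherry_def)
    moreover have "disjoint Q'" "Q' \<subseteq> Pow ?I"
      using Q' Q unfolding cherry_family_def disjoint_def by blast+
    ultimately have "Q' \<in> QQ" using Q' by (auto simp: QQ_def T_def)
    moreover have "S' \<in> SS" using S' by (simp add: SS_def)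
    ultimately have "(S', Q') \<in> SS \<times> QQ" by blast
    from nf[OF this] show False using f ch by (simp add: F_def)
  qed
  with f that show thesis by blast
qed

section \<open>Monochromatic induced paths in the host graph\<close>

text \<open>Every edge of \<open>G\<close> inside \<open>set P\<close>, whatever its colour, joins
  consecutive vertices of the path and therefore has colour \<open>col\<close>.\<close>

lemma induced_path_subgraph:
  assumes E: "\<And>e. e \<in> edges G \<Longrightarrow> e \<subseteq> vertices G \<and> card e = 2"
    and P: "ind_path (edges G) {e \<in> edges G. c e = col} P"
    and V: "set P \<subseteq> vertices G"
  shows "\<exists>K. is_induced_subgraph K G \<and> graph_iso (path_graph (length P)) K \<and> monochromatic c K"
proof -
  define K where "K = G\<lparr>vertices := set P, edges := {e \<in> edges G. e \<subseteq> set P}\<rparr>"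
  have K: "vertices K = set P" "edges K = {e \<in> edges G. e \<subseteq> set P}" by (simp_all add: K_def)
  have no_loop: "{v} \<notin> edges G" for v using E[of "{v}"] by auto
  note nth = ind_path_nth[OF P no_loop]
  have "bij_betw (\<lambda>i. P ! i) {..<length P} (set P)"
    by (rule bij_betw_nth[OF ind_path_distinct[OF P]]) auto
  moreover have "{u, v} \<in> edges (path_graph (length P)) \<longleftrightarrow> {P ! u, P ! v} \<in> edges K"
    if "u < length P" "v < length P" for u v
  proof -
    have "{u, v} \<in> edges (path_graph (length P)) \<longleftrightarrow> v = Suc u \<or> u = Suc v"
      using that by (auto simp: path_graph_def doubleton_eq_iff)
    also have "\<dots> \<longleftrightarrow> {P ! u, P ! v} \<in> edges K" using nth that by (auto simp: K)
    finally show ?thesis .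
  qed
  ultimately have "graph_iso (path_graph (length P)) K"
    unfolding graph_iso_def by (intro exI[of _ "\<lambda>i. P ! i"]) (simp add: K path_graph_def)
  moreover have "c e = col" if "e \<in> edges K" for e
  proof -
    have e: "e \<in> edges G" "e \<subseteq> set P" using that by (auto simp: K)
    obtain x y where "e = {x, y}" using E[OF e(1)] by (auto simp: card_2_iff)
    then obtain i j where ij: "e = {P ! i, P ! j}" "i < length P" "j < length P"
      using e by (auto simp: in_set_conv_nth)
    then have "j = Suc i \<or> i = Suc j" using nth e by auto
    then show ?thesis
      using ij ind_path_nth_Suc[OF P, of i] ind_path_nth_Suc[OF P, of j]
      by (auto simp: insert_commute)
  qed
  then have "monochromatic c K" unfolding monochromatic_def by blast
  moreover have "is_induced_subgraph K G" using V by (simp add: is_induced_subgraph_def K)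
  ultimately show ?thesis by blast
qed

text \<open>The constants fit as follows: failure would give \<open>62 * n\<close> indices in
  \<open>J\<close>, yet \<open>3 * card Q + card S\<close> is below
  \<open>3 * (20 * n) + 2 * n\<close>. The majority density 63 exceeds 62 so that \<open>W\<close>
  still spans enough edges when the search exhausts it.\<close>

lemma long_monochromatic_induced_path:
  fixes f :: "nat \<Rightarrow> 'a \<times> 'a" and c :: "'a set \<Rightarrow> bool" and M :: nat and V :: "'a set"
  defines "g \<equiv> \<lambda>i. {fst (f i), snd (f i)}"
  defines "E \<equiv> {e \<in> g ` {..<M}. card e = 2}"
  assumes V: "finite V" "card V \<ge> 62 * n" and M: "M = 126 * card V"
    and f: "f \<in> {..<M} \<rightarrow> V \<times> V"
    and few: "\<And>S Q. S \<subseteq> V \<Longrightarrow> card S \<le> 2 * n \<Longrightarrow> cherry_family {..<M} S f Q \<Longrightarrow> card Q < 20 * n"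
  obtains col P where "ind_path E {e \<in> E. c e = col} P" "set P \<subseteq> V" "length P = n"
proof -
  have gV: "g i \<subseteq> V" if "i < M" for i
  proof -
    have "f i \<in> V \<times> V" using f that by auto
    then show ?thesis by (auto simp: g_def)
  qed
  obtain col where col: "63 * card V \<le> card {i\<in>{..<M}. c (g i) = col}"
  proof -
    have "{..<M} = {i\<in>{..<M}. c (g i) = True} \<union> {i\<in>{..<M}. c (g i) = False}" by auto
    from arg_cong[OF this, of card]
    have "M \<le> card {i\<in>{..<M}. c (g i) = True} + card {i\<in>{..<M}. c (g i) = False}"
      unfolding card_lessThan by (rule ord_eq_le_trans[OF _ card_Un_le])
    then have "63 * card V \<le> card {i\<in>{..<M}. c (g i) = True} \<or>
        63 * card V \<le> card {i\<in>{..<M}. c (g i) = False}"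
      unfolding M by linarith
    then show thesis using that by blast
  qed
  define I where "I = {i\<in>{..<M}. c (g i) = col}"
  obtain W where W: "W \<subseteq> V" "card I + 62 * card W \<le> card {i\<in>I. g i \<subseteq> W} + 62 * card V"
    and dense: "\<And>D. D \<subseteq> W \<Longrightarrow> 62 * card D \<le> card {i\<in>I. g i \<subseteq> W \<and> g i \<inter> D \<noteq> {}}"
    using dense_subset[of V I g 62] V gV unfolding I_def by auto
  have finW: "finite W" using W V finite_subset by blast
  define R where "R = {e \<in> E. c e = col}"
  obtain P D where PD: "ind_path E R P" "set P \<subseteq> W" "D \<subseteq> W" "set P \<inter> D = {}"
    and dead: "\<And>d u. d \<in> D \<Longrightarrow> u \<in> W \<Longrightarrow> u \<notin> set P \<Longrightarrow> u \<notin> D \<Longrightarrow> {d, u} \<in> R \<Longrightarrow>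
       \<exists>w\<in>set P \<union> D. w \<noteq> d \<and> {w, u} \<in> E"
    and size: "length P \<le> n" "card D \<le> n" "length P = n \<or> card D = n \<or> D = W"
    using dfs_induced_path[OF finW, of R E n n] unfolding R_def by blast
  have "length P = n"
  proof (rule ccontr)
    assume neq: "length P \<noteq> n"
    define S where "S = set P \<union> D"
    define J where "J = {i\<in>I. g i \<subseteq> W \<and> g i \<inter> D \<noteq> {}}"
    \<comment> \<open>The end opposite to a dead one. If both ends are dead, \<open>t i\<close> is
      still in \<open>S\<close>, a case covered by the \<open>card S\<close> term.\<close>
    define t where "t i = (if fst (f i) \<in> D then snd (f i) else fst (f i))" for i
    have S: "S \<subseteq> V" "finite S" "card S \<le> 2 * n"
    proof -
      show "S \<subseteq> V" using PD W S_def by blast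
      then show "finite S" using V finite_subset by blast
      have "card S \<le> card (set P) + card D" unfolding S_def by (rule card_Un_le)
      then show "card S \<le> 2 * n" using size card_length[of P] by linarith
    qed
    have J_ends: "\<exists>d\<in>D. f i = (d, t i) \<or> f i = (t i, d)" if "i \<in> J" for i
      using that by (cases "f i") (auto simp: J_def g_def t_def)
    obtain Q where Q: "cherry_family {..<M} S f Q" "card J \<le> 3 * card Q + card S"
    proof (rule many_disjoint_cherries[of "{..<M}" S J t f])
      show "J \<subseteq> {..<M}" by (auto simp: J_def I_def)
      show "spoke S (t i) (f i)" if "i \<in> J" for i
        using J_ends[OF that] by (auto simp: spoke_def S_def)
      show "\<exists>j\<in>{..<M}. j \<noteq> i \<and> spoke S (t i) (f j)" if i: "i \<in> J" "t i \<notin> S" for i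
      proof -
        obtain d where d: "d \<in> D" "f i = (d, t i) \<or> f i = (t i, d)" using J_ends i by blast
        then have gi: "g i = {d, t i}" by (auto simp: g_def)
        \<comment> \<open>So index \<open>i\<close> is not a loop and gives a genuine edge in
          \<open>R\<close>, to which the invariant on dead vertices applies.\<close>
        have "d \<noteq> t i" using d i by (auto simp: S_def)
        then have "card (g i) = 2" unfolding gi by simp
        then have "g i \<in> R" using i(1) unfolding R_def E_def J_def I_def by blast
        then have "{d, t i} \<in> R" unfolding gi .
        moreover have "t i \<in> W" using i(1) gi by (auto simp: J_def)
        ultimately obtain w where w: "w \<in> S" "w \<noteq> d" "{w, t i} \<in> E"
          using dead d(1) i(2) unfolding S_def by blast
        then obtain j where j: "j < M" "g j = {w, t i}" by (auto simp: E_def)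
        then have "j \<noteq> i" using gi w i(2) by (auto simp: doubleton_eq_iff)
        moreover have "spoke S (t i) (f j)"
          using j(2) w(1) by (cases "f j") (auto simp: g_def spoke_def doubleton_eq_iff)
        ultimately show ?thesis using j by blast
      qed
    qed (use S in auto)
    have "62 * n \<le> card J"
    proof (cases "card D = n")
      case True
      then show ?thesis using dense[OF PD(3)] by (simp add: J_def)
    next
      case False
      \<comment> \<open>All coloured edges inside \<open>W\<close> now count; there are at least
        \<open>(63 - 62) * card V\<close> of them, hence at least \<open>62 * n\<close>.\<close>
      then have "D = W" using size neq by blast
      then have "J = {i\<in>I. g i \<subseteq> W}" by (auto simp: J_def g_def)
      then show ?thesis using W(2) col V(2) unfolding I_def[symmetric] by simp
    qed
    then show False using few[OF S(1,3) Q(1)] Q(2) S(3) by linarith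
  qed
  then show thesis using that[of col P] PD W unfolding R_def by blast
qed

theorem theorem1p1:
  shows "\<forall>\<^sub>F n in sequentially. ind_size_ramsey (path_graph n) \<le> enat (5 * 10 ^ 7 * n)"
proof (rule eventually_sequentiallyI[of 1])
  fix n :: nat assume "1 \<le> n"
  then have n: "n > 0" by simp
  define N where "N = 200000 * n"
  define M where "M = 126 * N"
  obtain f where f: "f \<in> {..<M} \<rightarrow> {..<N} \<times> {..<N}" and few: "\<And>S Q. S \<subseteq> {..<N} \<Longrightarrow>
      card S \<le> 2 * n \<Longrightarrow> cherry_family {..<M} S f Q \<Longrightarrow> card Q < 20 * n"
    using ex_few_disjoint_cherries[OF n N_def M_def] by blast
  define g where "g i = {fst (f i), snd (f i)}" for i
  \<comment> \<open>Loops are dropped and repeated pairs merge, so \<open>G\<close> has at most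
    \<open>M\<close> edges.\<close>
  define G where "G = \<lparr>vertices = {..<N}, edges = {e \<in> g ` {..<M}. card e = 2}\<rparr>"
  have sub: "e \<subseteq> vertices G \<and> card e = 2" if "e \<in> edges G" for e
  proof -
    obtain i where i: "i < M" "e = g i" "card e = 2" using \<open>e \<in> edges G\<close> by (auto simp: G_def)
    have "f i \<in> {..<N} \<times> {..<N}" using f i(1) by auto
    then show ?thesis using i by (auto simp: G_def g_def)
  qed
  then have "simple_graph G" by (auto simp: simple_graph_def G_def)
  moreover have "induced_ramsey_for G (path_graph n)"
    unfolding induced_ramsey_for_def
  proof
    fix c :: "nat set \<Rightarrow> bool"
    obtain col P where P: "ind_path (edges G) {e \<in> edges G. c e = col} P"
        "set P \<subseteq> vertices G" "length P = n"
    proof (rule long_monochromatic_induced_path[of "{..<N}" n M f c])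
      show "f \<in> {..<M} \<rightarrow> {..<N} \<times> {..<N}" by (rule f)
    qed (use few in \<open>auto simp: G_def g_def[abs_def] N_def M_def\<close>)
    then show "\<exists>K. is_induced_subgraph K G \<and> graph_iso (path_graph n) K \<and> monochromatic c K"
      using induced_path_subgraph[OF sub P(1,2)] by simp
  qed
  ultimately have "ind_size_ramsey (path_graph n) \<le> enat (card (edges G))"
    unfolding ind_size_ramsey_def by (intro Inf_lower) blast
  also have "card (edges G) \<le> M"
  proof -
    have "card (edges G) \<le> card (g ` {..<M})" by (rule card_mono) (auto simp: G_def)
    also have "\<dots> \<le> M" using card_image_le[of "{..<M}" g] by simp
    finally show ?thesis .
  qed
  \<comment> \<open>The product \<open>126 * 200000\<close> is 25200000, about half of the allowed
    constant.\<close>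
  then have "enat (card (edges G)) \<le> enat (5 * 10 ^ 7 * n)" by (simp add: M_def N_def)
  finally show "ind_size_ramsey (path_graph n) \<le> enat (5 * 10 ^ 7 * n)" .
qed

end
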